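(* Let $V$ be a finite set of at least $3$ points in the plane $\mathbb{R}^2$. Then the number $N(V)$ of double-normal pairs in $V$ satisfies \[N(V)\leq 3\left\lfloor\frac{|V|}{2}\right\rfloor .\] This bound can be attained for all cardinalities $|V|\geq 3$; that is, for every integer $n\geq 3$ there exists a set $V\subset\mathbb{R}^2$ with $|V|=n$ and $N(V)=3\lfloor n/2\rfloor$. Moreover, if $|V|$ is even and $N(V)=3|V|/2$, then $V$ lies on a circle and is symmetric with respect to the centre of the circle.
   Context: For a finite set $V$ of points in Euclidean space $\mathbb{R}^d$, a double-normal pair of $V$ is an (unordered) pair $\{p,q\}$ of distinct points of $V$ such that $V$ lies in the closed strip bounded by the hyperplanes through $p$ and $q$, respectively, that are perpendicular to the segment $pq$. $N(V)$ denotes the number of double-normal pairs of $V$. *)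

theory Defs
  imports "HOL-Analysis.Analysis"
begin

text \<open>The closed strip between the two hyperplanes through \<open>p\<close> and \<open>q\<close> with normal
  vector \<open>q - p\<close>; it is symmetric in \<open>p\<close> and \<open>q\<close>.\<close>

definition normal_strip :: "'a::euclidean_space \<Rightarrow> 'a \<Rightarrow> 'a set" where
  "normal_strip p q = {x. (q - p) \<bullet> p \<le> (q - p) \<bullet> x \<and> (q - p) \<bullet> x \<le> (q - p) \<bullet> q}"

text \<open>Unordered pairs are represented as two-element sets.\<close>

definition double_normal_pairs :: "'a::euclidean_space set \<Rightarrow> 'a set set" where
  "double_normal_pairs V = {{p, q} | p q. p \<in> V \<and> q \<in> V \<and> p \<noteq> q \<and> V \<subseteq> normal_strip p q}"

definition num_double_normals :: "'a::euclidean_space set \<Rightarrow> nat" where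
  "num_double_normals V = card (double_normal_pairs V)"

definition symmetric_about :: "'a::euclidean_space \<Rightarrow> 'a set \<Rightarrow> bool" where
  "symmetric_about c V \<longleftrightarrow> (\<lambda>x. 2 *\<^sub>R c - x) ` V = V"

end

theory Submission
  imports Defs
begin

text \<open>
  Join the two points of every double-normal pair by an edge and let every point mark its
  leftmost edge. If \<open>p q\<close> is marked by neither endpoint, then \<open>p\<close> has an edge \<open>p q'\<close> to the left of
  \<open>p q\<close> and \<open>q\<close> has an edge \<open>q p'\<close> to the left of \<open>q p\<close>. No angle of the quadrilateral
  \<open>p q' q p'\<close> is obtuse, so it is a rectangle, and \<open>q'\<close>, \<open>p'\<close> are unique. Hence the unmarked
  edges form a matching, and there are at most \<open>n + n div 2\<close> edges.

  In the case of equality, passing from \<open>p q\<close> to the other diagonal \<open>p' q'\<close> gives a bijection onto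
  the edges that are unmarked for the reversed orientation, and it preserves sums of endpoints. It
  follows that both orientations have the same unmarked edges. A point missed by this matching would
  have a neighbour \<open>z\<close> and thus be the leftmost or rightmost neighbour of \<open>z\<close>, but these are
  covered; so \<open>n\<close> is even. The unmarked edges with a common midpoint \<open>c\<close> and length \<open>2 r\<close> are closed
  under passing to the other diagonals, which end in the neighbours on the hull, so every linear
  functional attains its maximum over \<open>V\<close> at an endpoint of such an edge. Therefore \<open>V\<close> lies in the
  disc with centre \<open>c\<close> and radius \<open>r\<close>, for every such \<open>c\<close> and \<open>r\<close>, and all these discs coincide.
\<close>

section \<open>Orientation in the plane\<close>

definition cross2 :: "real ^ 2 \<Rightarrow> real ^ 2 \<Rightarrow> real" where
  "cross2 a b = a $ 1 * b $ 2 - a $ 2 * b $ 1"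

lemma inner_real2: "a \<bullet> b = a $ 1 * b $ 1 + a $ 2 * b $ 2" for a b :: "real ^ 2"
  by (simp add: inner_vec_def sum_2)

lemma cross2_commute: "cross2 a b = - cross2 b a"
  by (simp add: cross2_def)

lemma cross2_minus_left [simp]: "cross2 (- a) b = - cross2 a b"
  by (simp add: cross2_def)

lemma cross2_minus_right [simp]: "cross2 a (- b) = - cross2 a b"
  by (simp add: cross2_def)

lemma cross2_self [simp]: "cross2 a a = 0"
  by (simp add: cross2_def)

text \<open>\<open>d\<close> and its quarter turn are orthogonal and of equal length, and
  \<open>cross2 d x\<close> is the inner product of \<open>x\<close> with that quarter turn; this is
  Parseval's identity scaled by \<open>d \<bullet> d\<close>.\<close>

lemma inner_cross2_product:
  "(d \<bullet> d) * (a \<bullet> b) = (d \<bullet> a) * (d \<bullet> b) + cross2 d a * cross2 d b"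
  by (simp add: inner_real2 cross2_def) algebra

text \<open>The addition formula for the sine, applied to the angles from \<open>a\<close> to
  \<open>b\<close> and from \<open>b\<close> to \<open>c\<close>.\<close>

lemma cross2_product:
  "(b \<bullet> b) * cross2 a c = (a \<bullet> b) * cross2 b c + (b \<bullet> c) * cross2 a b"
  by (simp add: inner_real2 cross2_def) algebra

lemma eq_zero_by_inner_cross2:
  assumes "d \<noteq> 0" "d \<bullet> x = 0" "cross2 d x = 0"
  shows "x = 0"
proof -
  have "(d \<bullet> d) * (x \<bullet> x) = 0"
    by (simp add: inner_cross2_product assms)
  with assms(1) show ?thesis by simp
qed

lemma eq_zero_by_two_inners:
  assumes "cross2 a b \<noteq> 0" "a \<bullet> x = 0" "b \<bullet> x = 0"
  shows "x = 0"
proof -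
  \<comment> \<open>Cramer's rule.\<close>
  have "cross2 a b * x $ 1 = (a \<bullet> x) * b $ 2 - (b \<bullet> x) * a $ 2"
    "cross2 a b * x $ 2 = (b \<bullet> x) * a $ 1 - (a \<bullet> x) * b $ 1"
    by (simp_all add: inner_real2 cross2_def algebra_simps)
  with assms show ?thesis by (simp add: vec_eq_iff forall_2)
qed

lemma eq_by_product_le:
  fixes X Y Z :: real
  assumes "0 < Z" "Z \<le> X" "Z \<le> Y" "X * Y \<le> Z * Z"
  shows "X = Z" "Y = Z"
proof -
  have "Z * Y \<le> X * Y" "X * Z \<le> X * Y"
    using assms by (auto intro: mult_right_mono mult_left_mono)
  then have "Z * Y \<le> Z * Z" "X * Z \<le> Z * Z" using assms(4) by linarith+
  then show "X = Z" "Y = Z" using assms(1-3) by (simp_all add: mult_le_cancel_left mult_le_cancel_right)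
qed

definition dnormal :: "(real ^ 2) set \<Rightarrow> real ^ 2 \<Rightarrow> real ^ 2 \<Rightarrow> bool" where
  "dnormal V p q \<longleftrightarrow> {p, q} \<in> double_normal_pairs V"

lemma normal_strip_commute: "normal_strip p q = normal_strip q p"
  by (auto simp: normal_strip_def inner_diff_left)

lemma dnormal_iff: "dnormal V p q \<longleftrightarrow> p \<in> V \<and> q \<in> V \<and> p \<noteq> q \<and> V \<subseteq> normal_strip p q"
  using normal_strip_commute
  by (fastforce simp: dnormal_def double_normal_pairs_def doubleton_eq_iff)

lemma dnormal_commute: "dnormal V p q \<longleftrightarrow> dnormal V q p"
  by (simp add: dnormal_def insert_commute)

text \<open>The geometric content of the strip: seen from either end of a double normal, no point of
  \<open>V\<close> makes an obtuse angle with the other end.\<close>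

lemma dnormal_strip:
  assumes "dnormal V p q" "x \<in> V"
  shows "0 \<le> (q - p) \<bullet> (x - p)" "(q - p) \<bullet> (x - q) \<le> 0"
  using assms by (auto simp: dnormal_iff normal_strip_def inner_diff_right)

lemma dnormal_mem:
  assumes "dnormal V p q"
  shows "p \<in> V" "q \<in> V" "p \<noteq> q"
  using assms by (auto simp: dnormal_iff)

section \<open>Leftmost and unmarked double normals\<close>

text \<open>The orientation \<open>s\<close> is a nonzero real; only its sign matters, so that every lemma
  can be applied to a configuration and to its mirror image.\<close>

definition is_left :: "real \<Rightarrow> real ^ 2 \<Rightarrow> real ^ 2 \<Rightarrow> real ^ 2 \<Rightarrow> bool" where
  "is_left s p q x \<longleftrightarrow> 0 < s * cross2 (q - p) (x - p)"

lemma is_left_flip: "is_left (- s) p q x \<longleftrightarrow> is_left s p x q"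
  by (simp add: is_left_def cross2_commute [of "q - p"])

lemma not_is_left_refl [simp]: "\<not> is_left s p q q"
  by (simp add: is_left_def)

text \<open>Two double normals at \<open>p\<close> on one line point the same way, and each far end
  lies in the strip of the other, so the far ends agree. Together with \<open>is_left_trans\<close>
  this orders the neighbours of \<open>p\<close> linearly.\<close>

lemma is_left_total:
  assumes "dnormal V p q" "dnormal V p x" "q \<noteq> x" "s \<noteq> 0"
  shows "is_left s p q x \<or> is_left s p x q"
proof (rule ccontr)
  assume "\<not> ?thesis"
  then have 0: "cross2 (q - p) (x - p) = 0"
    using \<open>s \<noteq> 0\<close> cross2_commute[of "q - p" "x - p"]
    by (auto simp: is_left_def not_less mult_le_0_iff zero_le_mult_iff)
  have eq: "((q - p) \<bullet> (q - p)) * ((x - p) \<bullet> (x - p)) = ((q - p) \<bullet> (x - p))\<^sup>2"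
    by (simp add: inner_cross2_product 0 power2_eq_square)
  have x: "(q - p) \<bullet> (x - p) \<le> (q - p) \<bullet> (q - p)"
    using dnormal_strip(2)[OF assms(1) dnormal_mem(2)[OF assms(2)]] 
    by (simp add: algebra_simps)
  have y: "(q - p) \<bullet> (x - p) \<le> (x - p) \<bullet> (x - p)"
    using dnormal_strip(2)[OF assms(2) dnormal_mem(2)[OF assms(1)]] 
    by (simp add: algebra_simps inner_commute)
  have z: "0 \<le> (q - p) \<bullet> (x - p)"
    using dnormal_strip(1)[OF assms(1) dnormal_mem(2)[OF assms(2)]] .
  have pos: "0 < (q - p) \<bullet> (q - p)" "0 < (x - p) \<bullet> (x - p)"
    using dnormal_mem[OF assms(1)] dnormal_mem[OF assms(2)] by auto
  define A B C where "A = (q - p) \<bullet> (q - p)" "B = (x - p) \<bullet> (x - p)" "C = (q - p) \<bullet> (x - p)"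
  have "A * B = C * C" "C \<le> A" "C \<le> B" "0 \<le> C" "0 < A" "0 < B"
    using eq x y z pos by (auto simp: A_B_C_def power2_eq_square)
  moreover from this have "0 < C" by (metis less_eq_real_def mult_pos_pos mult_zero_left order_less_irrefl)
  ultimately have "A = C" "B = C" using eq_by_product_le[of C A B] by auto
  then have "(q - x) \<bullet> (q - x) = 0"
    by (simp add: A_B_C_def algebra_simps inner_commute)
  with assms(3) show False by simp
qed

text \<open>Being to the left is not transitive around a full circle, but all angles between
  neighbours of \<open>p\<close> are at most right, and then the sine addition formula decides the
  sign.\<close>

lemma is_left_trans:
  assumes "dnormal V p q" "dnormal V p x" "dnormal V p y" "is_left s p q x" "is_left s p x y"
  shows "is_left s p q y"
proof -
  define a b c where "a = q - p" "b = x - p" "c = y - p"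
  have ab: "0 \<le> a \<bullet> b" and bc: "0 \<le> b \<bullet> c" and ac: "0 \<le> a \<bullet> c"
    using dnormal_strip(1) dnormal_mem(2) assms(1,2,3) unfolding a_b_c_def by blast+
  have l: "0 < s * cross2 a b" "0 < s * cross2 b c"
    using assms(4,5) by (auto simp: is_left_def a_b_c_def)
  have "b \<noteq> 0" using dnormal_mem[OF assms(2)] by (auto simp: a_b_c_def)
  then have B: "0 < b \<bullet> b" by simp
  have e: "(b \<bullet> b) * (s * cross2 a c) = (a \<bullet> b) * (s * cross2 b c) + (b \<bullet> c) * (s * cross2 a b)"
    using cross2_product[of b a c] by algebra
  \<comment> \<open>Two right angles would make \<open>a\<close> and \<open>c\<close> opposite,
    against \<open>ac\<close>.\<close>
  have nz: "\<not> (a \<bullet> b = 0 \<and> b \<bullet> c = 0)"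
  proof
    assume "a \<bullet> b = 0 \<and> b \<bullet> c = 0"
    then have "(b \<bullet> b) * (a \<bullet> c) = cross2 b a * cross2 b c"
      by (simp add: inner_cross2_product inner_commute)
    moreover have "0 \<le> (b \<bullet> b) * (a \<bullet> c)" using B ac by simp
    moreover have "0 < (s * cross2 a b) * (s * cross2 b c)" using l by simp
    then have "0 < (s * s) * - (cross2 b a * cross2 b c)"
      by (simp add: cross2_commute[of a b] mult.assoc mult.left_commute)
    then have "cross2 b a * cross2 b c < 0"
      by (simp add: zero_less_mult_iff mult_less_0_iff)
    ultimately show False by linarith
  qed
  have "0 < (a \<bullet> b) * (s * cross2 b c) + (b \<bullet> c) * (s * cross2 a b)"
  proof (cases "a \<bullet> b = 0")
    case True
    then show ?thesis using nz bc l by simp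
  next
    case False
    then have "0 < (a \<bullet> b) * (s * cross2 b c)" using ab l by simp
    moreover have "0 \<le> (b \<bullet> c) * (s * cross2 a b)" using bc l by simp
    ultimately show ?thesis by linarith
  qed
  then have "0 < s * cross2 a c"
    using e B by (metis zero_less_mult_pos)
  then show ?thesis by (simp add: is_left_def a_b_c_def)
qed

text \<open>Put \<open>X = A * (D - C)\<close>, \<open>Y = C * (D - A)\<close>,
  \<open>Z = K * H\<close>. The last two bounds multiply to \<open>X * Y \<le> Z * Z\<close>, while
  \<open>Z \<le> X\<close> and \<open>Z \<le> Y\<close>; so all estimates are equalities.\<close>

lemma rectangle_equations:
  fixes A C D H K :: real
  assumes "0 \<le> A" "A \<le> D" "0 \<le> C" "C \<le> D" "0 < K * H" "K * H \<le> A * (D - C)"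
    "K * H \<le> C * (D - A)" "A * (D - A) \<le> K * K" "C * (D - C) \<le> H * H"
  shows "A = C" "K = H" "K * K = A * (D - A)"
proof -
  define X Y Z where "X = A * (D - C)" "Y = C * (D - A)" "Z = K * H"
  have "(A * (D - A)) * (C * (D - C)) \<le> (K * K) * (H * H)"
    using assms by (intro mult_mono[of "A * (D - A)" "K * K"]) auto
  then have "X * Y \<le> Z * Z"
    by (simp add: X_Y_Z_def algebra_simps)
  moreover have "Z \<le> X" "Z \<le> Y" "0 < Z"
    using assms by (auto simp: X_Y_Z_def)
  ultimately have XY: "X = Z" "Y = Z"
    using eq_by_product_le[of Z X Y] by simp_all
  then have "A * D = C * D" by (simp add: X_Y_Z_def algebra_simps)
  moreover have "D \<noteq> 0" using assms by auto
  ultimately show AC: "A = C" by simp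
  have "Z \<le> K * K" "Z \<le> H * H" using assms XY AC by (auto simp: X_Y_Z_def)
  moreover have "(K * K) * (H * H) = Z * Z" by (simp add: X_Y_Z_def)
  ultimately have KH: "K * K = Z" "H * H = Z"
    using eq_by_product_le[OF \<open>0 < Z\<close>, of "K * K" "H * H"] by auto
  then show "K * K = A * (D - A)" using XY AC by (simp add: X_Y_Z_def)
  have "(K - H) * (K - H) = K * K - 2 * (K * H) + H * H" by algebra
  also have "\<dots> = 0" using KH by (simp add: X_Y_Z_def(3)[symmetric])
  finally have "(K - H) * (K - H) = 0" .
  then show "K = H" by simp
qed

text \<open>Two double normals that do not meet bound a quadrilateral without obtuse angles.\<close>

lemma two_left_rectangle:
  assumes pq: "dnormal V p q" and pa: "dnormal V p q'" and qb: "dnormal V q p'"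
    and l: "is_left s p q q'" "is_left s q p p'"
  shows "p' + q' = p + q" "(q' - p) \<bullet> (p' - p) = 0"
proof -
  define d a b where "d = q - p" "a = q' - p" "b = p' - q"
  \<comment> \<open>Up to the factor \<open>norm d\<close>, \<open>A\<close> and \<open>C\<close>
    are the distances from \<open>p\<close> to the foot of \<open>q'\<close> and from
    \<open>q\<close> to the foot of \<open>p'\<close> on the line \<open>p q\<close>, and
    \<open>K\<close> and \<open>H\<close> are signed heights.\<close>
  define A C D H K where "A = d \<bullet> a" "C = - (d \<bullet> b)" "D = d \<bullet> d"
    "H = - cross2 d b" "K = cross2 d a"
  note defs = d_a_b_def A_C_D_H_K_def
  have mem: "p \<in> V" "q \<in> V" "q' \<in> V" "p' \<in> V" and d0: "d \<noteq> 0"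
    using dnormal_mem[OF pq] dnormal_mem[OF pa] dnormal_mem[OF qb] by (auto simp: defs)
  have Da: "0 < D" using d0 by (simp add: defs)
  have 1: "0 \<le> A" "A \<le> D"
    using dnormal_strip[OF pq \<open>q' \<in> V\<close>] by (auto simp: defs algebra_simps)
  have 2: "0 \<le> C" "C \<le> D"
    using dnormal_strip[OF pq \<open>p' \<in> V\<close>] by (auto simp: defs algebra_simps inner_commute)
  \<comment> \<open>The angle at \<open>q'\<close> is not obtuse, so \<open>q'\<close> is not inside
    the circle with diameter \<open>p q\<close>; below, the same for \<open>p'\<close>.\<close>
  have "d \<bullet> a \<le> a \<bullet> a"
    using dnormal_strip(2)[OF pa \<open>q \<in> V\<close>] by (auto simp: defs algebra_simps inner_commute)
  then have "D * A \<le> D * (a \<bullet> a)" using Da by (simp only: A_C_D_H_K_def mult_le_cancel_left_pos)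
  then have 3: "A * (D - A) \<le> K * K"
    using inner_cross2_product[of d a a] by (simp add: A_C_D_H_K_def algebra_simps)
  have "- (d \<bullet> b) \<le> b \<bullet> b"
    using dnormal_strip(2)[OF qb \<open>p \<in> V\<close>] by (auto simp: defs algebra_simps inner_commute)
  then have "D * C \<le> D * (b \<bullet> b)" using Da by (simp only: A_C_D_H_K_def mult_le_cancel_left_pos)
  then have 4: "C * (D - C) \<le> H * H"
    using inner_cross2_product[of d b b] by (simp add: A_C_D_H_K_def algebra_simps)
  \<comment> \<open>Now the angle of the quadrilateral at \<open>p\<close>, and then the one at
    \<open>q\<close>.\<close>
  have "- (a \<bullet> b) \<le> d \<bullet> a"
    using dnormal_strip(1)[OF pa \<open>p' \<in> V\<close>] by (auto simp: defs algebra_simps inner_commute)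
  then have "D * - (a \<bullet> b) \<le> D * A" using Da by (simp only: A_C_D_H_K_def mult_le_cancel_left_pos)
  then have 5: "K * H \<le> A * (D - C)"
    using inner_cross2_product[of d a b] by (simp add: A_C_D_H_K_def algebra_simps)
  have "- (a \<bullet> b) \<le> - (d \<bullet> b)"
    using dnormal_strip(1)[OF qb \<open>q' \<in> V\<close>] by (auto simp: defs algebra_simps inner_commute)
  then have "D * - (a \<bullet> b) \<le> D * C" using Da by (simp only: A_C_D_H_K_def mult_le_cancel_left_pos)
  then have 6: "K * H \<le> C * (D - A)"
    using inner_cross2_product[of d a b] by (simp add: A_C_D_H_K_def algebra_simps)
  have "0 < s * cross2 d a" "0 < s * cross2 (- d) b"
    using l by (auto simp: is_left_def defs)
  then have "0 < s * K" "0 < s * H" by (simp_all add: A_C_D_H_K_def)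
  then have "0 < (s * K) * (s * H)" by (rule mult_pos_pos)
  then have "0 < (s * s) * (K * H)" by (simp add: mult_ac)
  then have 7: "0 < K * H" by (simp add: zero_less_mult_iff)
  note R = rectangle_equations[OF 1 2 7 5 6 3 4]
  have "a + b = 0"
    using R(1,2) by (intro eq_zero_by_inner_cross2[OF d0])
      (auto simp: A_C_D_H_K_def cross2_def algebra_simps)
  then show s: "p' + q' = p + q"
    by (simp add: d_a_b_def algebra_simps add_eq_0_iff)
  have "D * (a \<bullet> a) = D * A"
    using inner_cross2_product[of d a a] R(3) by (simp add: A_C_D_H_K_def algebra_simps)
  then have "a \<bullet> a = d \<bullet> a" using Da by (simp add: A_C_D_H_K_def)
  moreover have "p' - p = d - a"
    using s by (simp add: d_a_b_def algebra_simps) 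
  ultimately show "(q' - p) \<bullet> (p' - p) = 0"
    by (simp add: d_a_b_def(2)[symmetric] inner_diff_right inner_commute)
qed


text \<open>The edge that \<open>p\<close> marks: its leftmost one for positive \<open>s\<close>,
  its rightmost one for negative \<open>s\<close>.\<close>

definition extremal :: "(real ^ 2) set \<Rightarrow> real \<Rightarrow> real ^ 2 \<Rightarrow> real ^ 2 \<Rightarrow> bool" where
  "extremal V s p q \<longleftrightarrow> dnormal V p q \<and> (\<forall>x. dnormal V p x \<longrightarrow> \<not> is_left s p q x)"

definition unmarked :: "(real ^ 2) set \<Rightarrow> real \<Rightarrow> (real ^ 2) set set" where
  "unmarked V s =
    {e. \<exists>p q. e = {p, q} \<and> dnormal V p q \<and> \<not> extremal V s p q \<and> \<not> extremal V s q p}"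

lemma extremal_dnormal: "extremal V s p q \<Longrightarrow> dnormal V p q"
  by (simp add: extremal_def)

lemma extremal_unique:
  assumes "extremal V s p q" "extremal V s p r" "s \<noteq> 0"
  shows "q = r"
  using assms is_left_total unfolding extremal_def by blast

lemma doubleton_unmarked_iff:
  "{p, q} \<in> unmarked V s \<longleftrightarrow> dnormal V p q \<and> \<not> extremal V s p q \<and> \<not> extremal V s q p"
  by (auto simp: unmarked_def doubleton_eq_iff dnormal_commute)

text \<open>A single left neighbour \<open>p'\<close> of \<open>q\<close> forms a rectangle with
  every neighbour of \<open>p\<close> to the left of \<open>p q\<close>. Its fourth corner is
  determined, so there is only one such neighbour.\<close>

lemma unmarked_left_extremal:
  assumes "{p, q} \<in> unmarked V s" "dnormal V p x" "is_left s p q x"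
  shows "extremal V s p x"
proof -
  have pq: "dnormal V p q" "dnormal V q p"
    using assms(1) dnormal_commute by (auto simp: doubleton_unmarked_iff)
  obtain p' where p': "dnormal V q p'" "is_left s q p p'"
    using assms(1) pq by (auto simp: doubleton_unmarked_iff extremal_def)
  have "\<not> is_left s p x y" if y: "dnormal V p y" for y
  proof
    assume xy: "is_left s p x y"
    then have "is_left s p q y" using is_left_trans pq assms y by blast
    then have "p' + y = p' + x"
      using two_left_rectangle(1)[OF pq(1) _ p'(1) _ p'(2)] assms y by metis
    with xy show False by simp
  qed
  with assms(2) show ?thesis by (simp add: extremal_def)
qed

lemma unmarkedE:
  assumes "{p, q} \<in> unmarked V s"
  obtains p' q' where "extremal V s p q'" "extremal V s q p'"
    "is_left s p q q'" "is_left s q p p'" "p' + q' = p + q" "(q' - p) \<bullet> (p' - p) = 0"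
proof -
  have pq: "dnormal V p q" "dnormal V q p"
    using assms dnormal_commute by (auto simp: doubleton_unmarked_iff)
  obtain p' where p': "dnormal V q p'" "is_left s q p p'"
    using assms pq by (auto simp: doubleton_unmarked_iff extremal_def)
  obtain q' where q': "dnormal V p q'" "is_left s p q q'"
    using assms pq by (auto simp: doubleton_unmarked_iff extremal_def)
  show thesis
  proof (rule that)
    show "extremal V s p q'" using unmarked_left_extremal assms q' by blast
    show "extremal V s q p'"
      using unmarked_left_extremal[of q p] assms p' by (simp add: insert_commute)
  qed (use p' q' two_left_rectangle[OF pq(1) q'(1) p'(1) q'(2) p'(2)] in auto)
qed

text \<open>Of two edges at \<open>p\<close>, one is to the left of the other; if the other is
  unmarked, the first is the edge marked by \<open>p\<close>.\<close>

lemma unmarked_matching: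
  assumes "{p, q} \<in> unmarked V s" "{p, r} \<in> unmarked V s" "s \<noteq> 0"
  shows "q = r"
proof (rule ccontr)
  assume "q \<noteq> r"
  moreover have "dnormal V p q" "dnormal V p r"
    using assms by (auto simp: doubleton_unmarked_iff)
  ultimately have "is_left s p q r \<or> is_left s p r q"
    using is_left_total assms(3) by blast
  then have "extremal V s p r \<or> extremal V s p q"
    using unmarked_left_extremal assms \<open>dnormal V p q\<close> \<open>dnormal V p r\<close> by blast
  then show False using assms by (auto simp: doubleton_unmarked_iff)
qed

section \<open>Counting marked and unmarked pairs\<close>

definition leftmost :: "(real ^ 2) set \<Rightarrow> real \<Rightarrow> real ^ 2 \<Rightarrow> real ^ 2" where
  "leftmost V s p = (SOME q. extremal V s p q)"

lemma leftmost_eq: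
  assumes "extremal V s p q" "s \<noteq> 0"
  shows "leftmost V s p = q"
  unfolding leftmost_def using assms extremal_unique by blast

lemma unmarked_subset: "unmarked V s \<subseteq> double_normal_pairs V"
  by (auto simp: unmarked_def dnormal_def)

lemma double_normal_pair_cases:
  fixes V :: "(real ^ 2) set"
  assumes "e \<in> double_normal_pairs V"
  obtains p q where "e = {p, q}" "dnormal V p q"
  using assms by (auto simp: double_normal_pairs_def dnormal_iff)

lemma finite_double_normal_pairs:
  fixes V :: "(real ^ 2) set"
  assumes "finite V"
  shows "finite (double_normal_pairs V)"
  by (rule finite_subset[of _ "Pow V"]) (use assms in \<open>auto simp: double_normal_pairs_def\<close>)

lemma finite_unmarked: "finite V \<Longrightarrow> finite (unmarked V s)"
  using finite_double_normal_pairs finite_subset unmarked_subset by metis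

lemma Union_unmarked_subset: "\<Union> (unmarked V s) \<subseteq> V"
  by (auto simp: unmarked_def dest: dnormal_mem)

lemma unmarked_edge_at:
  assumes "e \<in> unmarked V s" "p \<in> e"
  obtains q where "e = {p, q}"
  using assms unfolding unmarked_def by (blast intro: insert_commute)

lemma mem_Union_unmarked_iff: "p \<in> \<Union> (unmarked V s) \<longleftrightarrow> (\<exists>q. {p, q} \<in> unmarked V s)"
  by (blast elim: unmarked_edge_at)

lemma card_unmarked_edge:
  assumes "e \<in> unmarked V s"
  shows "card e = 2"
  using assms by (auto simp: unmarked_def dest: dnormal_mem)

lemma pairwise_disjnt_unmarked:
  assumes "s \<noteq> 0"
  shows "pairwise disjnt (unmarked V s)"
proof (rule pairwiseI, rule ccontr)
  fix e f assume e: "e \<in> unmarked V s" and f: "f \<in> unmarked V s" and "e \<noteq> f" "\<not> disjnt e f"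
  then obtain p where "p \<in> e" "p \<in> f" by (auto simp: disjnt_def)
  then obtain q r where qr: "e = {p, q}" "f = {p, r}"
    using e f by (metis unmarked_edge_at)
  with unmarked_matching e f assms \<open>e \<noteq> f\<close> show False by blast
qed

lemma card_Union_unmarked:
  assumes "s \<noteq> 0"
  shows "card (\<Union> (unmarked V s)) = 2 * card (unmarked V s)"
proof -
  have "card (\<Union> (unmarked V s)) = sum card (unmarked V s)"
    by (rule card_Union_disjoint[OF pairwise_disjnt_unmarked[OF assms]])
      (metis card_unmarked_edge card.infinite zero_neq_numeral)
  also have "\<dots> = 2 * card (unmarked V s)"
    by (simp add: card_unmarked_edge)
  finally show ?thesis .
qed

text \<open>Each point marks at most one edge, so this bounds the number of marked pairs.
  Restricting to points that have a neighbour lets equality later force every point to have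
  one.\<close>

lemma marked_subset:
  assumes "s \<noteq> 0"
  shows "double_normal_pairs V - unmarked V s
    \<subseteq> (\<lambda>p. {p, leftmost V s p}) ` {p \<in> V. \<exists>q. dnormal V p q}"
proof
  fix e assume "e \<in> double_normal_pairs V - unmarked V s"
  then obtain p q where e: "e = {p, q}" and d: "dnormal V p q" and "extremal V s p q \<or> extremal V s q p"
    by (fastforce simp: unmarked_def elim: double_normal_pair_cases)
  then consider "q = leftmost V s p" | "p = leftmost V s q"
    using leftmost_eq assms by metis
  then show "e \<in> (\<lambda>p. {p, leftmost V s p}) ` {p \<in> V. \<exists>q. dnormal V p q}"
  proof cases
    case 1
    then show ?thesis using e d dnormal_mem(1)[OF d] by blast
  next
    case 2
    then have "e = {q, leftmost V s q}" using e by auto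
    then show ?thesis using d dnormal_mem(2)[OF d] dnormal_commute by blast
  qed
qed

lemma num_double_normals_bound:
  assumes "finite V" "s \<noteq> 0"
  shows "num_double_normals V \<le> card {p \<in> V. \<exists>q. dnormal V p q} + card (unmarked V s)"
    and "2 * card (unmarked V s) \<le> card V"
proof -
  have "card (double_normal_pairs V - unmarked V s) \<le> card {p \<in> V. \<exists>q. dnormal V p q}"
    by (rule surj_card_le[OF _ marked_subset]) (use assms in auto)
  moreover have "card (double_normal_pairs V - unmarked V s)
      = card (double_normal_pairs V) - card (unmarked V s)"
    using finite_unmarked[OF assms(1)] unmarked_subset by (rule card_Diff_subset)
  ultimately show "num_double_normals V \<le> card {p \<in> V. \<exists>q. dnormal V p q} + card (unmarked V s)"
    unfolding num_double_normals_def by linarith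
  show "2 * card (unmarked V s) \<le> card V"
    using card_mono[OF assms(1) Union_unmarked_subset] card_Union_unmarked[OF assms(2)] by metis
qed

text \<open>For an odd number of points this exceeds the sharp bound by one.\<close>

lemma num_double_normals_le:
  fixes V :: "(real ^ 2) set"
  assumes "finite V"
  shows "num_double_normals V \<le> card V + card V div 2"
proof -
  have "card {p \<in> V. \<exists>q. dnormal V p q} \<le> card V"
    using assms by (intro card_mono) auto
  then show ?thesis using num_double_normals_bound[OF assms, of 1] by linarith
qed

section \<open>Equality in the marking bound\<close>

text \<open>Equality in the marking bound rather than in the sharp one. The two bounds agree for
  even cardinality; for odd cardinality \<open>tight_even\<close> rules tightness out.\<close>

definition tight :: "(real ^ 2) set \<Rightarrow> bool" where
  "tight V \<longleftrightarrow> finite V \<and> num_double_normals V = card V + card V div 2"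

lemma tight_dnormal:
  assumes "tight V" "p \<in> V"
  shows "\<exists>q. dnormal V p q"
proof -
  have "finite V" using assms by (simp add: tight_def)
  note b = num_double_normals_bound[OF this, of 1]
  have "card V \<le> card {p \<in> V. \<exists>q. dnormal V p q}"
    using b assms(1) by (simp add: tight_def)
  then have "{p \<in> V. \<exists>q. dnormal V p q} = V"
    using \<open>finite V\<close> by (intro card_seteq) auto
  with assms(2) show ?thesis by blast
qed

lemma tight_card_unmarked:
  assumes "tight V" "s \<noteq> 0"
  shows "card (unmarked V s) = card V div 2"
proof -
  have fin: "finite V" using assms by (simp add: tight_def)
  have "card {p \<in> V. \<exists>q. dnormal V p q} \<le> card V"
    using fin by (intro card_mono) auto
  then show ?thesis
    using num_double_normals_bound[OF fin assms(2)] assms(1) by (simp add: tight_def)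
qed


section \<open>Rectangles under reversal of the orientation\<close>

lemma unmarked_left_only:
  assumes "{p, q} \<in> unmarked V s" "dnormal V p x" "is_left s p q x" "s \<noteq> 0"
  shows "x = leftmost V s p"
  using unmarked_left_extremal leftmost_eq assms by metis

text \<open>Otherwise the rectangle with diagonal \<open>p q\<close> and the one with diagonal
  \<open>p x\<close> would give the triangle \<open>p q x\<close> right angles at both
  \<open>x\<close> and \<open>q\<close>.\<close>

lemma extremal_at_unmarked_not_unmarked_flip:
  assumes pq: "{p, q} \<in> unmarked V s" and x: "extremal V s p x" and "s \<noteq> 0"
  shows "{p, x} \<notin> unmarked V (- s)"
proof
  assume px: "{p, x} \<in> unmarked V (- s)"
  obtain p' q' where 1: "extremal V s p q'" "is_left s p q q'" "p' + q' = p + q"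
    "(q' - p) \<bullet> (p' - p) = 0"
    using unmarkedE[OF pq] by metis
  obtain p'' q'' where 2: "extremal V (- s) p q''" "is_left (- s) p x q''" "p'' + q'' = p + x"
    "(q'' - p) \<bullet> (p'' - p) = 0"
    using unmarkedE[OF px] by metis
  have x_eq: "q' = x" using extremal_unique 1(1) x \<open>s \<noteq> 0\<close> by blast
  have "dnormal V p q" using pq by (simp add: doubleton_unmarked_iff)
  moreover have "is_left (- s) p x q" using 1(2) by (simp add: is_left_flip x_eq)
  ultimately have q_eq: "q'' = q"
    using unmarked_left_only[OF px] leftmost_eq[OF 2(1)] \<open>s \<noteq> 0\<close> by auto
  have "p' - p = q - x" "p'' - p = x - q"
    using 1(3) 2(3) by (simp_all add: x_eq q_eq algebra_simps)
  then have "(x - p) \<bullet> (q - x) = 0" "(q - p) \<bullet> (x - q) = 0"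
    using 1(4) 2(4) by (simp_all add: x_eq q_eq)
  then have "(x - q) \<bullet> (x - q) = 0" by (simp add: algebra_simps inner_commute)
  then have "x = q" by simp
  then show False using 1(2) by (simp add: x_eq)
qed

text \<open>For \<open>- s\<close> the edge \<open>p x\<close> is not marked by \<open>p\<close>,
  since \<open>p q\<close> lies further in that direction, yet it is not unmarked; so
  \<open>x\<close> marks it.\<close>

lemma extremal_flip:
  assumes pq: "{p, q} \<in> unmarked V s" and x: "extremal V s p x" and "s \<noteq> 0"
  shows "extremal V (- s) x p"
proof -
  have d: "dnormal V p x" "dnormal V p q"
    using pq x by (auto simp: doubleton_unmarked_iff extremal_def)
  have "q \<noteq> x" using pq x by (auto simp: doubleton_unmarked_iff)
  then have "is_left s p q x"
    using is_left_total[OF d(2,1)] x d \<open>s \<noteq> 0\<close> by (auto simp: extremal_def)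
  then have "\<not> extremal V (- s) p x"
    using d by (auto simp: extremal_def is_left_flip)
  then show ?thesis
    using extremal_at_unmarked_not_unmarked_flip[OF assms] d
    by (auto simp: doubleton_unmarked_iff)
qed

text \<open>Two rectangles on the same side \<open>p q'\<close>, one with diagonal \<open>p q\<close> and one with diagonal
  \<open>q' y\<close>, coincide, because each of the two diagonals is a double normal.\<close>

lemma unmarked_partner_flip:
  assumes pq: "{p, q} \<in> unmarked V s"
    and q': "extremal V s p q'" and p': "extremal V s q p'"
    and y: "{q', y} \<in> unmarked V (- s)" and "s \<noteq> 0"
  shows "y = p'"
proof -
  obtain q0 p0 where 1: "extremal V s p q0" "extremal V s q p0" "is_left s p q q0"
    "p0 + q0 = p + q" "(q0 - p) \<bullet> (p0 - p) = 0"
    using unmarkedE[OF pq] by metis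
  have eqs: "q0 = q'" "p0 = p'" using extremal_unique 1(1,2) q' p' \<open>s \<noteq> 0\<close> by blast+
  obtain r x where 2: "extremal V (- s) q' x" "extremal V (- s) y r" "is_left (- s) q' y x"
    "r + x = q' + y" "(x - q') \<bullet> (r - q') = 0"
    using unmarkedE[OF y] by metis
  have x_eq: "x = p"
    using extremal_unique[OF 2(1) extremal_flip[OF pq q' \<open>s \<noteq> 0\<close>]] \<open>s \<noteq> 0\<close> by simp
  \<comment> \<open>\<open>a\<close> is the side shared by the two rectangles; \<open>e\<close> and
    \<open>f\<close> are their other sides at \<open>p\<close>, both perpendicular to
    \<open>a\<close>.\<close>
  define a e f where "a = q' - p" "e = p' - p" "f = y - p"
  have "r - q' = f" using 2(4) by (simp add: x_eq a_e_f_def algebra_simps)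
  then have perp: "a \<bullet> e = 0" "a \<bullet> f = 0"
    using 1(5) 2(5) by (auto simp: x_eq eqs a_e_f_def inner_diff_left)
  have q: "q - p = a + e" using 1(4) by (simp add: eqs a_e_f_def algebra_simps)
  have r: "r - p = a + f" using 2(4) by (simp add: x_eq a_e_f_def algebra_simps)
  have mem: "r \<in> V" "p' \<in> V"
    using 2(2) p' by (auto dest!: extremal_dnormal dnormal_mem(2))
  \<comment> \<open>The strip of \<open>p q\<close> contains the corner \<open>r\<close>, so
    \<open>f\<close> is not longer than \<open>e\<close>; the strip of \<open>q' y\<close> contains
    \<open>p'\<close>, which gives the converse.\<close>
  have "(q - p) \<bullet> (r - q) \<le> 0"
    using dnormal_strip(2) pq mem(1) by (auto simp: doubleton_unmarked_iff)
  moreover have "r - q = f - e" using q r by (simp add: algebra_simps)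
  ultimately have ef: "e \<bullet> f \<le> e \<bullet> e"
    using perp by (simp add: q inner_add_left inner_diff_right)
  have "(y - q') \<bullet> (p' - y) \<le> 0"
    using dnormal_strip(2) y mem(2) by (auto simp: doubleton_unmarked_iff)
  moreover have "p' - y = e - f" "y - q' = f - a" by (simp_all add: a_e_f_def)
  ultimately have fe: "f \<bullet> e \<le> f \<bullet> f"
    using perp by (simp add: inner_diff_left inner_diff_right)
  have "0 < s * cross2 (a + e) a"
    using 1(3) by (simp add: is_left_def q eqs a_e_f_def(1))
  then have l1: "0 < s * cross2 e a" by (simp add: cross2_def algebra_simps)
  have "0 < - s * cross2 (f - a) (- a)"
    using 2(3) by (simp add: is_left_def x_eq a_e_f_def)
  then have l2: "0 < s * cross2 f a" by (simp add: cross2_def algebra_simps)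
  define A E F where "A = a \<bullet> a" "E = cross2 a e" "F = cross2 a f"
  have "a \<noteq> 0" using l1 by (auto simp: cross2_def)
  then have "0 < A" by (simp add: A_E_F_def)
  have "A * (e \<bullet> f) = E * F" "A * (e \<bullet> e) = E * E" "A * (f \<bullet> f) = F * F"
    by (simp_all add: A_E_F_def inner_cross2_product perp)
  then have "E * F \<le> E * E" "E * F \<le> F * F"
    using ef fe \<open>0 < A\<close> by (metis mult_le_cancel_left_pos inner_commute)+
  moreover have "0 < (s * E) * (s * F)"
    using mult_pos_pos[OF l1 l2] by (simp add: A_E_F_def cross2_commute[of a])
  then have "0 < (s * s) * (E * F)" by (simp add: mult_ac)
  then have "0 < E * F" by (simp add: zero_less_mult_iff)
  moreover have "(E * E) * (F * F) = (E * F) * (E * F)" by simp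
  ultimately have "E * E = E * F" "F * F = E * F"
    using eq_by_product_le[of "E * F" "E * E" "F * F"] by auto
  then have "E = F" using \<open>0 < E * F\<close> by auto
  then have "e - f = 0"
    using perp \<open>a \<noteq> 0\<close>
    by (intro eq_zero_by_inner_cross2[of a]) (auto simp: A_E_F_def cross2_def algebra_simps)
  then show ?thesis by (simp add: a_e_f_def)
qed


lemma tight_card_uncovered:
  assumes "tight V" "s \<noteq> 0"
  shows "card (V - \<Union> (unmarked V s)) = card V mod 2"
proof -
  have "finite V" using assms by (simp add: tight_def)
  then have "card (V - \<Union> (unmarked V s)) = card V - card (\<Union> (unmarked V s))"
    using Union_unmarked_subset finite_subset by (intro card_Diff_subset) blast+
  then show ?thesis
    using card_Union_unmarked[OF assms(2)] tight_card_unmarked[OF assms]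
    by (simp add: minus_mult_div_eq_mod)
qed

text \<open>The diagonal other than \<open>p q\<close> is unmarked for \<open>- s\<close>: at most
  one point is uncovered, so \<open>q'\<close> or \<open>p'\<close> has an unmarked edge, whose
  other end \<open>unmarked_partner_flip\<close> identifies.\<close>

lemma tight_partner:
  assumes "tight V" and pq: "{p, q} \<in> unmarked V s"
    and q': "extremal V s p q'" and p': "extremal V s q p'" and "s \<noteq> 0"
  shows "{q', p'} \<in> unmarked V (- s)" "q' + p' = p + q" "(q' - p) \<bullet> (p' - p) = 0"
proof -
  obtain q0 p0 where 1: "extremal V s p q0" "extremal V s q p0"
    "p0 + q0 = p + q" "(q0 - p) \<bullet> (p0 - p) = 0"
    using unmarkedE[OF pq] by metis
  have eqs: "q0 = q'" "p0 = p'" using extremal_unique 1(1,2) q' p' \<open>s \<noteq> 0\<close> by blast+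
  show "q' + p' = p + q" using 1(3) by (simp add: eqs add.commute)
  show perp: "(q' - p) \<bullet> (p' - p) = 0" using 1(4) by (simp add: eqs)
  have mem: "p' \<in> V" "q' \<in> V" and "q' \<noteq> p"
    using q' p' by (auto dest!: extremal_dnormal dest: dnormal_mem)
  then have "p' \<noteq> q'" using perp by auto
  have "q' \<in> \<Union> (unmarked V (- s)) \<or> p' \<in> \<Union> (unmarked V (- s))"
  proof (rule ccontr)
    assume "\<not> ?thesis"
    then have "{p', q'} \<subseteq> V - \<Union> (unmarked V (- s))" using mem by blast
    then have "card {p', q'} \<le> card (V - \<Union> (unmarked V (- s)))"
      using assms(1) by (intro card_mono) (auto simp: tight_def)
    also have "\<dots> \<le> 1" using tight_card_uncovered[OF assms(1), of "- s"] \<open>s \<noteq> 0\<close> by simp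
    finally show False using \<open>p' \<noteq> q'\<close> by simp
  qed
  then consider y where "{q', y} \<in> unmarked V (- s)" | y where "{p', y} \<in> unmarked V (- s)"
    unfolding mem_Union_unmarked_iff by blast
  then show "{q', p'} \<in> unmarked V (- s)"
  proof cases
    case 1
    then show ?thesis using unmarked_partner_flip[OF pq q' p'] \<open>s \<noteq> 0\<close> by blast
  next
    case 2
    \<comment> \<open>Exchanging \<open>p\<close> and \<open>q\<close> exchanges \<open>q'\<close>
      and \<open>p'\<close>.\<close>
    have "{q, p} \<in> unmarked V s" using pq by (simp add: insert_commute)
    then show ?thesis
      using unmarked_partner_flip[OF _ p' q' 2 \<open>s \<noteq> 0\<close>] 2 by (simp add: insert_commute)
  qed
qed

text \<open>On the ends of an unmarked edge, \<open>leftmost\<close> produces the other diagonal of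
  the rectangle. By \<open>extremal_flip\<close>, reversing the orientation leads back.\<close>

lemma tight_leftmost_image:
  assumes "tight V" "e \<in> unmarked V s" "s \<noteq> 0"
  shows "leftmost V s ` e \<in> unmarked V (- s)"
    and "leftmost V (- s) ` leftmost V s ` e = e"
    and "\<Sum> (leftmost V s ` e) = \<Sum> e"
proof -
  obtain p q where e: "e = {p, q}" using assms(2) by (auto simp: unmarked_def)
  then have pq: "{p, q} \<in> unmarked V s" "{q, p} \<in> unmarked V s"
    using assms(2) by (auto simp: insert_commute)
  obtain q' p' where 1: "extremal V s p q'" "extremal V s q p'"
    using unmarkedE[OF pq(1)] by metis
  note t = tight_partner[OF assms(1) pq(1) 1 assms(3)]
  have im: "leftmost V s ` e = {q', p'}"
    using leftmost_eq 1 assms(3) by (simp add: e)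
  then show "leftmost V s ` e \<in> unmarked V (- s)" using t(1) by simp
  have "leftmost V (- s) q' = p" "leftmost V (- s) p' = q"
    using leftmost_eq extremal_flip pq 1 assms(3) by simp_all
  then show "leftmost V (- s) ` leftmost V s ` e = e" unfolding im by (simp add: e)
  have "p \<noteq> q" "q' \<noteq> p'" using pq t(1) by (auto simp: doubleton_unmarked_iff dest: dnormal_mem)
  then show "\<Sum> (leftmost V s ` e) = \<Sum> e" unfolding im using t(2) by (simp add: e)
qed

lemma sum_Union_unmarked:
  assumes "s \<noteq> 0"
  shows "\<Sum> (\<Union> (unmarked V s)) = (\<Sum>e\<in>unmarked V s. \<Sum> e)"
proof -
  have "sum id (\<Union> (unmarked V s)) = (sum \<circ> sum) id (unmarked V s)"
  proof (rule sum.Union_disjoint)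
    show "\<forall>e\<in>unmarked V s. finite e"
      by (auto simp: unmarked_def)
    show "\<forall>e\<in>unmarked V s. \<forall>f\<in>unmarked V s. e \<noteq> f \<longrightarrow> e \<inter> f = {}"
      using pairwise_disjnt_unmarked[OF assms] by (auto simp: pairwise_def disjnt_def)
  qed
  then show ?thesis by (simp add: id_def)
qed

text \<open>The rectangles pair the edges unmarked for \<open>s\<close> with those unmarked for \<open>- s\<close>, and the two
  edges in such a pair have the same sum. Since at most one point is uncovered, comparing the
  sums over all covered points identifies the uncovered points.\<close>

lemma tight_Union_unmarked_flip:
  assumes "tight V" "s \<noteq> 0"
  shows "\<Union> (unmarked V (- s)) = \<Union> (unmarked V s)"
proof -
  have fin: "finite V" using assms by (simp add: tight_def)
  let ?f = "\<lambda>e. leftmost V s ` e"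
  have inj: "inj_on ?f (unmarked V s)"
    using tight_leftmost_image(2)[OF assms(1) _ assms(2)]
    by (intro inj_on_inverseI[where g = "\<lambda>e. leftmost V (- s) ` e"]) auto
  have "?f ` unmarked V s = unmarked V (- s)"
  \<comment> \<open>Both sides have \<open>card V div 2\<close> elements, so injectivity gives
    surjectivity.\<close>
  proof (rule card_seteq)
    show "?f ` unmarked V s \<subseteq> unmarked V (- s)"
      using tight_leftmost_image(1)[OF assms(1) _ assms(2)] by auto
    show "card (unmarked V (- s)) \<le> card (?f ` unmarked V s)"
      using tight_card_unmarked[OF assms(1)] assms(2) by (simp add: card_image[OF inj])
  qed (simp add: finite_unmarked fin)
  then have "(\<Sum>e\<in>unmarked V (- s). \<Sum> e) = (\<Sum>e\<in>unmarked V s. \<Sum> (?f e))"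
    using sum.reindex[OF inj, of "\<lambda>e. \<Sum> e"] by simp
  also have "\<dots> = (\<Sum>e\<in>unmarked V s. \<Sum> e)"
    by (rule sum.cong[OF refl]) (rule tight_leftmost_image(3)[OF assms(1) _ assms(2)])
  finally have "\<Sum> (\<Union> (unmarked V (- s))) = \<Sum> (\<Union> (unmarked V s))"
    using assms(2) by (simp add: sum_Union_unmarked)
  then have sums: "\<Sum> (V - \<Union> (unmarked V (- s))) = \<Sum> (V - \<Union> (unmarked V s))"
    by (simp add: sum_diff fin Union_unmarked_subset)
  have cards: "card (V - \<Union> (unmarked V s)) = card V mod 2"
    "card (V - \<Union> (unmarked V (- s))) = card V mod 2"
    using tight_card_uncovered[OF assms(1)] assms(2) by simp_all
  have "V - \<Union> (unmarked V (- s)) = V - \<Union> (unmarked V s)"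
  proof (cases "even (card V)")
    case True
    then have "V \<subseteq> \<Union> (unmarked V s)" "V \<subseteq> \<Union> (unmarked V (- s))"
      using cards fin by (simp_all add: even_iff_mod_2_eq_zero)
    then show ?thesis by blast
  next
    case False
    then have "card V mod 2 = 1" by presburger
    with cards obtain a b where "V - \<Union> (unmarked V s) = {a}" "V - \<Union> (unmarked V (- s)) = {b}"
      by (metis card_1_singletonE)
    with sums show ?thesis by simp
  qed
  then show ?thesis using Union_unmarked_subset by blast
qed

text \<open>Both ends of the edge are covered for \<open>- s\<close>, so
  \<open>extremal_flip\<close> would turn a mark for \<open>- s\<close> into a mark for
  \<open>s\<close> at the opposite end.\<close>

lemma tight_unmarked_flip_subset:
  assumes "tight V" "s \<noteq> 0"
  shows "unmarked V s \<subseteq> unmarked V (- s)"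
proof
  fix e assume "e \<in> unmarked V s"
  then obtain p q where e: "e = {p, q}" and pq: "{p, q} \<in> unmarked V s" "{q, p} \<in> unmarked V s"
    by (auto simp: unmarked_def insert_commute)
  have "p \<in> \<Union> (unmarked V (- s))" "q \<in> \<Union> (unmarked V (- s))"
    using tight_Union_unmarked_flip[OF assms] pq by auto
  then obtain p' q' where "{p, p'} \<in> unmarked V (- s)" "{q, q'} \<in> unmarked V (- s)"
    unfolding mem_Union_unmarked_iff by blast
  then have "extremal V (- s) p q \<Longrightarrow> extremal V s q p" "extremal V (- s) q p \<Longrightarrow> extremal V s p q"
    using extremal_flip[of _ _ V "- s"] assms(2) by auto
  then show "e \<in> unmarked V (- s)"
    using pq by (auto simp: e doubleton_unmarked_iff)
qed

lemma tight_unmarked_flip: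
  assumes "tight V" "s \<noteq> 0"
  shows "unmarked V (- s) = unmarked V s"
  using tight_unmarked_flip_subset[OF assms] tight_unmarked_flip_subset[OF assms(1), of "- s"] assms(2)
  by simp

text \<open>\<open>w\<close> is a corner of the rectangle with diagonal \<open>z q\<close>, hence an
  end of the other diagonal.\<close>

lemma tight_no_left_uncovered:
  assumes "tight V" "s \<noteq> 0" "{z, q} \<in> unmarked V s" "dnormal V z w" "is_left s z q w"
  shows "w \<in> \<Union> (unmarked V s)"
proof -
  have w: "extremal V s z w" using unmarked_left_extremal assms by blast
  obtain p' where "extremal V s q p'" using unmarkedE[OF assms(3)] by metis
  from tight_partner(1)[OF assms(1,3) w this assms(2)]
  show ?thesis using tight_unmarked_flip[OF assms(1,2)] by auto
qed

lemma tight_even: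
  assumes "tight V"
  shows "even (card V)"
proof (rule ccontr)
  assume "odd (card V)"
  then have "card V mod 2 = 1" by presburger
  then obtain w where w: "V - \<Union> (unmarked V 1) = {w}"
    using tight_card_uncovered[OF assms, of 1] card_1_singletonE by (metis zero_neq_one)
  then have "w \<in> V" by blast
  then obtain z where z: "dnormal V w z" "dnormal V z w"
    using tight_dnormal[OF assms, of w] dnormal_commute by blast
  then have "z \<in> V" "z \<noteq> w" by (auto dest: dnormal_mem)
  then have "z \<notin> V - \<Union> (unmarked V 1)" unfolding w by simp
  then have "z \<in> \<Union> (unmarked V 1)"
    using \<open>z \<in> V\<close> by blast
  then obtain q where q: "{z, q} \<in> unmarked V 1" "{z, q} \<in> unmarked V (- 1)"
    unfolding mem_Union_unmarked_iff using tight_unmarked_flip[OF assms, of 1] by auto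
  then have "q \<noteq> w" using w by auto
  moreover have "dnormal V z q" using q by (simp add: doubleton_unmarked_iff)
  ultimately have "is_left 1 z q w \<or> is_left (- 1) z q w"
    using is_left_total[of V z q w 1] z by (auto simp: is_left_flip)
  then have "w \<in> \<Union> (unmarked V 1) \<or> w \<in> \<Union> (unmarked V (- 1))"
    using tight_no_left_uncovered[OF assms] q z by (metis neg_equal_0_iff_equal zero_neq_one)
  then show False using w tight_unmarked_flip[OF assms, of 1] by auto
qed

lemma tight_unmarked_cover:
  assumes "tight V" "p \<in> V"
  shows "\<exists>q. {p, q} \<in> unmarked V 1"
proof -
  have "V - \<Union> (unmarked V 1) = {}"
    using tight_card_uncovered[OF assms(1), of 1] tight_even[OF assms(1)] assms(1)
    by (simp add: even_iff_mod_2_eq_zero tight_def)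
  then show ?thesis using assms(2) unfolding mem_Union_unmarked_iff[symmetric] by blast
qed

text \<open>The set lies in the cone at \<open>p\<close> spanned by the sides \<open>p' - p\<close> and \<open>p'' - p\<close> of the two
  rectangles with diagonal \<open>p q\<close>, so that a local maximum of a linear functional is global.\<close>

lemma local_max_imp_max:
  assumes l: "{p, q} \<in> unmarked V s" "extremal V s p q'" "extremal V s q p'"
    and r: "{p, q} \<in> unmarked V (- s)" "extremal V (- s) p q''" "extremal V (- s) q p''"
    and u: "u \<bullet> p' \<le> u \<bullet> p" "u \<bullet> p'' \<le> u \<bullet> p" and "x \<in> V" and "s \<noteq> 0"
  shows "u \<bullet> x \<le> u \<bullet> p"
proof -
  obtain q0 p0 where 1: "extremal V s p q0" "extremal V s q p0" "is_left s p q q0"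
    "p0 + q0 = p + q" "(q0 - p) \<bullet> (p0 - p) = 0"
    using unmarkedE[OF l(1)] by metis
  have eq1: "q0 = q'" "p0 = p'" using extremal_unique 1(1,2) l \<open>s \<noteq> 0\<close> by blast+
  obtain q1 p1 where 2: "extremal V (- s) p q1" "extremal V (- s) q p1" "is_left (- s) p q q1"
    "p1 + q1 = p + q" "(q1 - p) \<bullet> (p1 - p) = 0"
    using unmarkedE[OF r(1)] by metis
  have eq2: "q1 = q''" "p1 = p''"
    using extremal_unique[of V "- s"] 2(1,2) r \<open>s \<noteq> 0\<close> by (metis neg_equal_0_iff_equal)+
  define a b e f y where "a = q' - p" "b = q'' - p" "e = p' - p" "f = p'' - p" "y = x - p"
  note defs = this
  have d: "dnormal V p q'" "dnormal V p q''" "dnormal V p q"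
    and mem: "p' \<in> V" "p'' \<in> V" "q' \<in> V" "q'' \<in> V"
    using l r by (auto simp: doubleton_unmarked_iff extremal_def dest: dnormal_mem)
  have perp: "a \<bullet> e = 0" "b \<bullet> f = 0" using 1(5) 2(5) by (simp_all add: defs eq1 eq2)
  have y: "0 \<le> a \<bullet> y" "0 \<le> b \<bullet> y"
    using dnormal_strip(1)[OF d(1) \<open>x \<in> V\<close>] dnormal_strip(1)[OF d(2) \<open>x \<in> V\<close>]
    by (simp_all add: defs)
  have af: "0 \<le> a \<bullet> f" and be: "0 \<le> b \<bullet> e"
    using dnormal_strip(1)[OF d(1) mem(2)] dnormal_strip(1)[OF d(2) mem(1)] by (simp_all add: defs)
  have ac: "is_left s p q q'" "is_left s p q'' q"
    using 1(3) 2(3) by (simp_all add: eq1 eq2 is_left_flip)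
  then have "is_left s p q'' q'" using is_left_trans[OF d(2) d(3) d(1)] by blast
  then have ba: "cross2 b a \<noteq> 0" "cross2 a b \<noteq> 0"
    by (auto simp: is_left_def defs cross2_commute[of "q'' - p" "q' - p"])
  \<comment> \<open>Neither rectangle is degenerate.\<close>
  have nz: "e \<noteq> 0" "f \<noteq> 0"
  proof -
    have "e = (q - p) - a" "f = (q - p) - b"
      using 1(4) 2(4) by (simp_all add: eq1 eq2 defs algebra_simps)
    moreover have "q' \<noteq> q" "q'' \<noteq> q" using ac by auto
    ultimately show "e \<noteq> 0" "f \<noteq> 0" by (auto simp: defs)
  qed
  have "a \<bullet> f \<noteq> 0" "b \<bullet> e \<noteq> 0"
    using eq_zero_by_two_inners[OF ba(1), of f] eq_zero_by_two_inners[OF ba(1), of e] perp nz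
    by auto
  with af be have pos: "0 < a \<bullet> f" "0 < b \<bullet> e" by auto
  \<comment> \<open>Pairing with \<open>a\<close> kills \<open>e\<close> and pairing with
    \<open>b\<close> kills \<open>f\<close>, which determines the coefficients. They are nonnegative
    because \<open>x\<close> lies in the strips of \<open>p q'\<close> and
    \<open>p q''\<close>.\<close>
  have "y - ((b \<bullet> y / (b \<bullet> e)) *\<^sub>R e + (a \<bullet> y / (a \<bullet> f)) *\<^sub>R f) = 0"
    using pos perp by (intro eq_zero_by_two_inners[OF ba(1)]) (simp_all add: inner_diff_right inner_add_right)
  then have y_eq: "y = (b \<bullet> y / (b \<bullet> e)) *\<^sub>R e + (a \<bullet> y / (a \<bullet> f)) *\<^sub>R f"
    by simp
  have "u \<bullet> e \<le> 0" "u \<bullet> f \<le> 0" using u by (simp_all add: defs inner_diff_right)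
  moreover have "0 \<le> b \<bullet> y / (b \<bullet> e)" "0 \<le> a \<bullet> y / (a \<bullet> f)"
    using y pos by simp_all
  ultimately have "(b \<bullet> y / (b \<bullet> e)) * (u \<bullet> e) \<le> 0" "(a \<bullet> y / (a \<bullet> f)) * (u \<bullet> f) \<le> 0"
    by (blast intro: mult_nonneg_nonpos)+
  then have "u \<bullet> y \<le> 0"
    by (subst y_eq) (simp add: inner_add_right)
  then show ?thesis by (simp add: defs inner_diff_right)
qed

section \<open>The enclosing disc and the circle\<close>

lemma rectangle_diagonals:
  fixes p q p' q' :: "'a :: real_inner"
  assumes "q' + p' = p + q" "(q' - p) \<bullet> (p' - p) = 0"
  shows "dist q' p' = dist p q"
proof -
  have q: "q - p = (q' - p) + (p' - p)" using assms(1) by (simp add: algebra_simps)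
  have "(q' - p') \<bullet> (q' - p') = ((q' - p) - (p' - p)) \<bullet> ((q' - p) - (p' - p))" by simp
  also have "\<dots> = (q - p) \<bullet> (q - p)"
    unfolding q using assms(2)
    by (simp only: inner_diff_left inner_diff_right inner_add_left inner_add_right inner_commute)
  finally have "dist q' p' = dist q p" by (simp add: dist_norm norm_eq_sqrt_inner)
  then show ?thesis by (simp add: dist_commute)
qed

lemma tight_max:
  assumes "tight V" "{p0, q0} \<in> unmarked V 1" "x \<in> V"
  shows "\<exists>p q. {p, q} \<in> unmarked V 1 \<and> p + q = p0 + q0 \<and> dist p q = dist p0 q0 \<and> u \<bullet> x \<le> u \<bullet> p"
proof -
  \<comment> \<open>The ends of the unmarked edges with the midpoint and length of
    \<open>p0 q0\<close>. A maximiser of \<open>u\<close> over this finite set is compared with its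
    two neighbouring corners.\<close>
  define K where "K = {p. \<exists>q. {p, q} \<in> unmarked V 1 \<and> p + q = p0 + q0 \<and> dist p q = dist p0 q0}"
  have "K \<subseteq> V" by (auto simp: K_def doubleton_unmarked_iff dest: dnormal_mem)
  then have fin: "finite ((\<bullet>) u ` K)" using assms(1) by (auto simp: tight_def intro: finite_subset)
  have "p0 \<in> K" using assms(2) by (auto simp: K_def)
  then have "Max ((\<bullet>) u ` K) \<in> (\<bullet>) u ` K" using fin by (intro Max_in) auto
  then obtain p where "p \<in> K" and p_Max: "Max ((\<bullet>) u ` K) = u \<bullet> p" by blast
  then have max: "u \<bullet> y \<le> u \<bullet> p" if "y \<in> K" for y
    using that fin Max_ge[of "(\<bullet>) u ` K" "u \<bullet> y"] by simp
  obtain q where q: "{p, q} \<in> unmarked V 1" "p + q = p0 + q0" "dist p q = dist p0 q0"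
    using \<open>p \<in> K\<close> by (auto simp: K_def)
  have flip: "unmarked V (- 1) = unmarked V 1" using tight_unmarked_flip[OF assms(1), of 1] by simp
  \<comment> \<open>The other diagonal of a rectangle has the same midpoint and length, so
    \<open>K\<close> is closed under passing to it on either side.\<close>
  have key: "\<exists>q' p'. extremal V s p q' \<and> extremal V s q p' \<and> p' \<in> K" if "s = 1 \<or> s = - 1" for s
  proof -
    have s: "unmarked V s = unmarked V 1" "unmarked V (- s) = unmarked V 1" "s \<noteq> 0"
      using that by (elim disjE; simp only: flip minus_minus; simp)+
    have pq: "{p, q} \<in> unmarked V s" using q(1) s(1) by simp
    obtain q' p' where 1: "extremal V s p q'" "extremal V s q p'"
      using unmarkedE[OF pq] by metis
    note t = tight_partner[OF assms(1) pq 1 s(3), unfolded s(2)]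
    have "p' \<in> K"
      using t rectangle_diagonals[OF t(2,3)] q(2,3)
      by (auto simp: K_def insert_commute add.commute dist_commute intro!: exI[of _ q'])
    with 1 show ?thesis by blast
  qed
  obtain q' p' where 1: "extremal V 1 p q'" "extremal V 1 q p'" "p' \<in> K" using key[of 1] by auto
  obtain q'' p'' where 2: "extremal V (- 1) p q''" "extremal V (- 1) q p''" "p'' \<in> K"
    using key[of "- 1"] by auto
  have "u \<bullet> x \<le> u \<bullet> p"
    by (rule local_max_imp_max[OF q(1) 1(1,2) _ 2(1,2) max[OF 1(3)] max[OF 2(3)] assms(3)])
      (use flip q(1) in auto)
  with q show ?thesis by blast
qed

lemma tight_subset_cball:
  assumes "tight V" "{p, q} \<in> unmarked V 1"
  shows "V \<subseteq> cball (midpoint p q) (dist p q / 2)"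
proof
  fix x assume "x \<in> V"
  define c where "c = midpoint p q"
  \<comment> \<open>The functional is chosen in the direction of \<open>x\<close> itself, so that
    Cauchy-Schwarz bounds \<open>norm (x - c)\<close>.\<close>
  obtain p' q' where 1: "p' + q' = p + q" "dist p' q' = dist p q" "(x - c) \<bullet> x \<le> (x - c) \<bullet> p'"
    using tight_max[OF assms \<open>x \<in> V\<close>] by metis
  have "c = midpoint p' q'" using 1(1) by (simp add: c_def midpoint_def)
  then have r: "norm (p' - c) = dist p q / 2"
    using 1(2) by (metis dist_midpoint(1) dist_norm)
  have "norm (x - c) * norm (x - c) = (x - c) \<bullet> (x - c)"
    by (simp add: power2_norm_eq_inner[symmetric] power2_eq_square)
  also have "\<dots> \<le> (x - c) \<bullet> (p' - c)" using 1(3) by (simp add: inner_diff_right)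
  also have "\<dots> \<le> norm (x - c) * norm (p' - c)" by (rule norm_cauchy_schwarz)
  finally have "norm (x - c) \<le> norm (p' - c)"
    by (cases "x = c") simp_all
  then show "x \<in> cball (midpoint p q) (dist p q / 2)"
    using r by (simp add: c_def dist_norm norm_minus_commute)
qed

text \<open>By the parallelogram law, \<open>a + b\<close> has squared norm at most zero, where
  \<open>a\<close> and \<open>b\<close> are the vectors from \<open>c\<close> to \<open>p\<close>
  and \<open>q\<close>.\<close>

lemma midpoint_eq_center:
  fixes p q c :: "'a :: real_inner"
  assumes "dist c p \<le> dist p q / 2" "dist c q \<le> dist p q / 2"
  shows "midpoint p q = c"
proof -
  define a b where "a = p - c" "b = q - c"
  have n: "norm a \<le> norm (a - b) / 2" "norm b \<le> norm (a - b) / 2"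
    using assms by (simp_all add: a_b_def dist_norm norm_minus_commute)
  have "norm a ^ 2 \<le> (norm (a - b) / 2) ^ 2" "norm b ^ 2 \<le> (norm (a - b) / 2) ^ 2"
    using n by (auto intro: power_mono)
  then have "a \<bullet> a \<le> (a - b) \<bullet> (a - b) / 4" "b \<bullet> b \<le> (a - b) \<bullet> (a - b) / 4"
    by (simp_all add: power_divide power2_norm_eq_inner)
  then have "(a + b) \<bullet> (a + b) \<le> 0"
    by (simp add: inner_simps inner_commute)
  then have "a + b = 0" by (simp add: inner_gt_zero_iff not_less[symmetric])
  then have "p + q = 2 *\<^sub>R c" by (simp add: a_b_def algebra_simps scaleR_2)
  then show ?thesis by (simp add: midpoint_def)
qed

lemma tight_circle:
  assumes "tight V" "V \<noteq> {}"
  shows "\<exists>c r. r > 0 \<and> V \<subseteq> sphere c r \<and> symmetric_about c V"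
proof -
  obtain p q where pq: "{p, q} \<in> unmarked V 1" using assms tight_unmarked_cover by blast
  define c r where "c = midpoint p q" "r = dist p q / 2"
  have mem: "x \<in> V" "y \<in> V" if "{x, y} \<in> unmarked V 1" for x y
    using that by (auto simp: doubleton_unmarked_iff dest: dnormal_mem)
  \<comment> \<open>Each unmarked edge lies in the disc having any other as diameter. Hence all have
    the same length, and each is a diameter of the disc of \<open>p q\<close>.\<close>
  have le: "dist x y \<le> dist x' y'" if "{x, y} \<in> unmarked V 1" "{x', y'} \<in> unmarked V 1" for x y x' y'
  proof -
    have "x \<in> cball (midpoint x' y') (dist x' y' / 2)" "y \<in> cball (midpoint x' y') (dist x' y' / 2)"
      using tight_subset_cball[OF assms(1) that(2)] mem[OF that(1)] by auto
    then show ?thesis using dist_triangle3[of x y "midpoint x' y'"] by simp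
  qed
  have center: "midpoint x y = c" "dist x y = 2 * r" if "{x, y} \<in> unmarked V 1" for x y
  proof -
    show d: "dist x y = 2 * r" using le[OF that pq] le[OF pq that] by (simp add: c_r_def)
    have "x \<in> cball c r" "y \<in> cball c r"
      using tight_subset_cball[OF assms(1) pq] mem[OF that] by (auto simp: c_r_def)
    then show "midpoint x y = c" using d by (intro midpoint_eq_center) auto
  qed
  have sphere: "V \<subseteq> sphere c r"
  proof
    fix x assume "x \<in> V"
    then obtain y where "{x, y} \<in> unmarked V 1" using tight_unmarked_cover[OF assms(1)] by blast
    from center[OF this] show "x \<in> sphere c r"
      by (metis dist_commute dist_midpoint(1) mem_sphere nonzero_mult_div_cancel_left zero_neq_numeral)
  qed
  have sub: "2 *\<^sub>R c - x \<in> V" if x: "x \<in> V" for x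
  proof -
    obtain y where y: "{x, y} \<in> unmarked V 1" using tight_unmarked_cover[OF assms(1) x] by blast
    have "2 *\<^sub>R c = x + y" unfolding center(1)[OF y, symmetric] by (simp add: midpoint_def)
    then show ?thesis using mem[OF y] by simp
  qed
  have "(\<lambda>x. 2 *\<^sub>R c - x) ` V = V"
  proof
    show "V \<subseteq> (\<lambda>x. 2 *\<^sub>R c - x) ` V"
    proof
      fix x assume "x \<in> V"
      then show "x \<in> (\<lambda>x. 2 *\<^sub>R c - x) ` V"
        using sub by (intro image_eqI[of _ _ "2 *\<^sub>R c - x"]) auto
    qed
  qed (use sub in auto)
  moreover have "r > 0" using pq by (auto simp: c_r_def doubleton_unmarked_iff dest: dnormal_mem)
  ultimately show ?thesis using sphere by (auto simp: symmetric_about_def)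
qed

text \<open>For odd cardinality the marking bound exceeds this one by exactly one, and
  \<open>tight_even\<close> excludes its attainment.\<close>

lemma num_double_normals_le_sharp:
  fixes V :: "(real ^ 2) set"
  assumes "finite V"
  shows "num_double_normals V \<le> 3 * (card V div 2)"
proof (cases "even (card V)")
  case True
  then show ?thesis using num_double_normals_le[OF assms] by presburger
next
  case False
  then have "num_double_normals V \<noteq> card V + card V div 2"
    using tight_even assms by (auto simp: tight_def)
  with False show ?thesis using num_double_normals_le[OF assms] by presburger
qed

section \<open>Regular polygons\<close>

definition circle_point :: "real \<Rightarrow> real ^ 2" where
  "circle_point x = vector [cos x, sin x]"

lemma inner_circle_point: "circle_point x \<bullet> circle_point y = cos (x - y)"
  by (simp add: circle_point_def inner_real2 cos_diff)

lemma circle_point_add_pi: "circle_point (x + pi) = - circle_point x"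
  by (simp add: circle_point_def vec_eq_iff forall_2)

lemma circle_point_eq_iff:
  "circle_point x = circle_point y \<longleftrightarrow> (\<exists>n::int. x - y = of_int n * 2 * pi)"
proof -
  have "circle_point x = circle_point y \<longleftrightarrow> cos x = cos y \<and> sin x = sin y"
    by (simp add: circle_point_def vec_eq_iff forall_2)
  also have "\<dots> \<longleftrightarrow> cos (x - y) = 1"
  proof
    assume "cos (x - y) = 1"
    then have "(circle_point x - circle_point y) \<bullet> (circle_point x - circle_point y) = 0"
      using cos_minus[of "x - y"] by (simp add: inner_diff_left inner_diff_right inner_circle_point)
    then show "cos x = cos y \<and> sin x = sin y"
      by (simp add: circle_point_def vec_eq_iff forall_2)
  qed (simp add: cos_diff flip: power2_eq_square)
  finally show ?thesis by (simp add: cos_one_2pi_int)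
qed

text \<open>The chord has half-length \<open>cos (\<theta> / 2)\<close>, and the centre projects to
  its midpoint. The assumption bounds the distance from that midpoint to the projection of the point
  at angle \<open>y\<close>.\<close>

lemma circle_point_strip:
  fixes x y \<theta> :: real
  defines "p \<equiv> circle_point x" and "q \<equiv> circle_point (x + \<theta> + pi)"
  assumes "\<bar>cos (x - y + \<theta> / 2)\<bar> \<le> cos (\<theta> / 2)"
  shows "circle_point y \<in> normal_strip p q" "0 \<in> normal_strip p q"
proof -
  have q: "q = - circle_point (x + \<theta>)" by (simp add: q_def circle_point_add_pi)
  have c: "1 + cos \<theta> = 2 * (cos (\<theta> / 2) * cos (\<theta> / 2))"
    using cos_double_cos[of "\<theta> / 2"] by (simp add: power2_eq_square)
  have d: "(q - p) \<bullet> p = - (1 + cos \<theta>)" "(q - p) \<bullet> q = 1 + cos \<theta>"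
    using cos_minus[of \<theta>] by (simp_all add: q p_def inner_diff_left inner_circle_point)
  have "cos (x + \<theta> - y) + cos (x - y) = 2 * (cos (x - y + \<theta> / 2) * cos (\<theta> / 2))"
    using cos_plus_cos[of "x + \<theta> - y" "x - y"] by (simp add: field_simps)
  then have y: "(q - p) \<bullet> circle_point y = - 2 * (cos (x - y + \<theta> / 2) * cos (\<theta> / 2))"
    by (simp add: q p_def inner_diff_left inner_circle_point)
  have nn: "0 \<le> cos (\<theta> / 2)" using assms(3) by linarith
  have "\<bar>cos (x - y + \<theta> / 2) * cos (\<theta> / 2)\<bar> \<le> cos (\<theta> / 2) * cos (\<theta> / 2)"
    unfolding abs_mult using assms(3) nn by (intro mult_mono) auto
  then show "circle_point y \<in> normal_strip p q"
    unfolding normal_strip_def mem_Collect_eq d y c by linarith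
  show "0 \<in> normal_strip p q"
    using nn by (auto simp: normal_strip_def d c)
qed

lemma abs_cos_odd_multiple_le:
  assumes "odd k" "\<bar>k\<bar> < 4 * int m"
  shows "\<bar>cos (of_int k * (pi / (2 * real m)))\<bar> \<le> cos (pi / (2 * real m))"
proof -
  define b where "b = pi / (2 * real m)"
  \<comment> \<open>Subtracting \<open>2 * int m\<close> shifts the angle by \<open>pi\<close>,
    which preserves the absolute cosine and leaves an angle between \<open>b\<close> and
    \<open>pi - b\<close>.\<close>
  define a where "a = (if \<bar>k\<bar> < 2 * int m then \<bar>k\<bar> else \<bar>k\<bar> - 2 * int m)"
  have m: "0 < m" using assms(2) by (cases m) auto
  have pi: "pi = of_int (2 * int m) * b" using m by (simp add: b_def)
  have b: "0 < b" using m by (simp add: b_def)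
  have "odd \<bar>k\<bar>" using assms(1) by simp
  then have "\<bar>k\<bar> \<noteq> 2 * int m" by (metis dvd_triv_left)
  have "odd a" using \<open>odd \<bar>k\<bar>\<close> by (simp add: a_def)
  then have a: "1 \<le> a" "a \<le> 2 * int m - 1"
    using assms(2) \<open>\<bar>k\<bar> \<noteq> 2 * int m\<close> by (auto simp: a_def elim!: oddE)
  have abs_k: "\<bar>cos (of_int k * b)\<bar> = \<bar>cos (of_int \<bar>k\<bar> * b)\<bar>"
    by (cases "0 \<le> k") auto
  have "\<bar>cos (of_int k * b)\<bar> = \<bar>cos (of_int a * b)\<bar>"
  proof (cases "\<bar>k\<bar> < 2 * int m")
    case False
    then have "of_int \<bar>k\<bar> * b = of_int a * b + pi"
      unfolding pi by (simp add: a_def algebra_simps)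
    then show ?thesis using abs_k by simp
  qed (use abs_k in \<open>simp add: a_def\<close>)
  moreover have l: "b \<le> of_int a * b" using a b by simp
  moreover have "of_int a * b \<le> of_int (2 * int m - 1) * b"
    using a(2) b by (intro mult_right_mono) (simp_all only: of_int_le_iff less_imp_le)
  then have u: "of_int a * b \<le> pi - b" unfolding pi by (simp add: algebra_simps)
  have "cos (of_int a * b) \<le> cos b"
    using l u b by (intro cos_monotone_0_pi_le) auto
  moreover have "cos (pi - b) \<le> cos (of_int a * b)"
    using l u b by (intro cos_monotone_0_pi_le) auto
  then have "- cos b \<le> cos (of_int a * b)" by simp
  ultimately show ?thesis by (simp add: b_def)
qed

text \<open>Vertices of the regular polygon with \<open>2 * m\<close> vertices. Indices are not
  reduced; adding \<open>m\<close> gives the antipode.\<close>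

definition gon_point :: "nat \<Rightarrow> nat \<Rightarrow> real ^ 2" where
  "gon_point m j = circle_point (real j * (pi / real m))"

lemma gon_point_eq_iff:
  assumes "0 < m"
  shows "gon_point m i = gon_point m j \<longleftrightarrow> int (2 * m) dvd int i - int j"
proof -
  have "gon_point m i = gon_point m j \<longleftrightarrow>
      (\<exists>n::int. real i * (pi / real m) - real j * (pi / real m) = of_int n * 2 * pi)"
    by (simp add: gon_point_def circle_point_eq_iff)
  also have "\<dots> \<longleftrightarrow> (\<exists>n::int. of_int (int i - int j) = (of_int (int (2 * m) * n) :: real))"
  proof (intro ex_cong1)
    fix n :: int
    have "real i * (pi / real m) - real j * (pi / real m) = of_int (int i - int j) * (pi / real m)"
      "of_int n * 2 * pi = of_int (int (2 * m) * n) * (pi / real m)"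
      using assms by (simp_all add: field_simps)
    then show "real i * (pi / real m) - real j * (pi / real m) = of_int n * 2 * pi \<longleftrightarrow>
        of_int (int i - int j) = (of_int (int (2 * m) * n) :: real)"
      using assms by (simp only: mult_cancel_right) simp
  qed
  also have "\<dots> \<longleftrightarrow> int (2 * m) dvd int i - int j"
    by (simp only: of_int_eq_iff dvd_def)
  finally show ?thesis .
qed

definition gon :: "nat \<Rightarrow> (real ^ 2) set" where
  "gon m = gon_point m ` {..<2 * m}"

lemma gon_point_mem:
  assumes "0 < m"
  shows "gon_point m j \<in> gon m"
proof -
  have "gon_point m j = gon_point m (j mod (2 * m))"
    using assms by (simp add: gon_point_eq_iff zmod_int mod_eq_dvd_iff[symmetric])
  then show ?thesis using assms by (auto simp: gon_def)
qed

lemma small_dvd_imp_zero: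
  fixes a d :: int
  assumes "d dvd a" "\<bar>a\<bar> < d"
  shows "a = 0"
  using assms dvd_imp_le_int[of a d] by fastforce

lemma card_gon:
  assumes "0 < m"
  shows "card (gon m) = 2 * m"
proof -
  have "inj_on (gon_point m) {..<2 * m}"
  proof (rule inj_onI)
    fix i j assume "i \<in> {..<2 * m}" "j \<in> {..<2 * m}" "gon_point m i = gon_point m j"
    then have "int i - int j = 0"
      using assms by (intro small_dvd_imp_zero[of "int (2 * m)"]) (auto simp: gon_point_eq_iff)
    then show "i = j" by simp
  qed
  then show ?thesis by (simp add: gon_def card_image)
qed

lemma zero_notin_gon: "0 \<notin> gon m"
proof
  assume "0 \<in> gon m"
  then obtain x where "circle_point x = 0" by (auto simp: gon_def gon_point_def)
  then show False using inner_circle_point[of x x] by simp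
qed

text \<open>\<open>t = 0\<close> gives the diameters and \<open>t = 1\<close> the chords one step
  away from them. The centre is allowed in \<open>W\<close> to serve odd cardinalities.\<close>

lemma gon_pairs_strip:
  assumes "W \<subseteq> insert 0 (gon m)" "i < 2 * m" "t \<le> 1"
  shows "W \<subseteq> normal_strip (gon_point m i) (gon_point m (i + m + t))"
proof -
  have m: "0 < m" using assms(2) by simp
  define x \<theta> where angle_defs: "x = real i * (pi / real m)" "\<theta> = real t * (pi / real m)"
  have q: "gon_point m (i + m + t) = circle_point (x + \<theta> + pi)"
    using m by (simp add: gon_point_def angle_defs field_simps)
  have strip: "\<bar>cos (x - real j * (pi / real m) + \<theta> / 2)\<bar> \<le> cos (\<theta> / 2)" if "j < 2 * m" for j
  proof (cases "t = 0")
    case False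
    then have t: "t = 1" using assms(3) by simp
    \<comment> \<open>The half-step makes every relevant angle an odd multiple of
      \<open>pi / (2 * real m)\<close>.\<close>
    have "x - real j * (pi / real m) + \<theta> / 2
        = of_int (2 * (int i - int j) + 1) * (pi / (2 * real m))"
      using m by (simp add: angle_defs t field_simps)
    moreover have "\<theta> / 2 = pi / (2 * real m)" by (simp add: angle_defs t)
    moreover have "\<bar>2 * (int i - int j) + 1\<bar> < 4 * int m" using assms(2) that by (simp add: abs_less_iff)
    ultimately show ?thesis
      using abs_cos_odd_multiple_le[of "2 * (int i - int j) + 1" m] by (simp only:) simp
  qed (simp add: angle_defs)
  have "gon m \<subseteq> normal_strip (circle_point x) (circle_point (x + \<theta> + pi))"
    using circle_point_strip(1)[OF strip] by (auto simp: gon_def gon_point_def)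
  moreover have "0 \<in> normal_strip (circle_point x) (circle_point (x + \<theta> + pi))"
    using circle_point_strip(2)[OF strip[of 0]] m by simp
  moreover have "gon_point m i = circle_point x" by (simp add: gon_point_def angle_defs)
  ultimately show ?thesis using assms(1) unfolding q by auto
qed

text \<open>There are \<open>m\<close> diameters, each having two starting vertices, and
  \<open>2 * m\<close> distinct near-diameters.\<close>

lemma num_double_normals_gon:
  assumes "2 \<le> m" "gon m \<subseteq> W" "W \<subseteq> insert 0 (gon m)"
  shows "3 * m \<le> num_double_normals W"
proof -
  let ?v = "gon_point m"
  define f where "f = (\<lambda>t i. {?v i, ?v (i + m + t)})"
  have m: "0 < m" using assms(1) by simp
  note eq = gon_point_eq_iff[OF m]
  have fin: "finite W" using assms(3) by (rule finite_subset) (simp add: gon_def)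
  then have fin_N: "finite (double_normal_pairs W)"
    by (rule finite_double_normal_pairs)
  have neq: "?v i \<noteq> ?v (i + m + t)" if "t \<le> 1" for i t
  proof
    assume "?v i = ?v (i + m + t)"
    then have "int (2 * m) dvd - int (m + t)" by (simp add: eq)
    then have "- int (m + t) = 0"
      using assms(1) that by (intro small_dvd_imp_zero) auto
    then show False using m by simp
  qed
  have pair: "f t i \<in> double_normal_pairs W" if "t \<le> 1" "i < 2 * m" for t i
    unfolding f_def double_normal_pairs_def
    using gon_pairs_strip[OF assms(3) that(2,1)] neq[OF that(1)] gon_point_mem[OF m] assms(2) by blast
  have small: "i = j" if "int (2 * m) dvd int i - int j" "i < 2 * m" "j < 2 * m" for i j
    using small_dvd_imp_zero[OF that(1)] that(2,3) by simp
  have no_dvd: "\<not> int (2 * m) dvd 1" "\<not> int (2 * m) dvd 2"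
    using small_dvd_imp_zero[of "int (2 * m)" 1] small_dvd_imp_zero[of "int (2 * m)" 2] assms(1)
    by auto
  have inj0: "inj_on (f 0) {..<m}"
  proof (rule inj_onI)
    fix i j assume ij: "i \<in> {..<m}" "j \<in> {..<m}" "f 0 i = f 0 j"
    then consider "int (2 * m) dvd int i - int j" | "int (2 * m) dvd int i - int (j + m)"
      by (auto simp: f_def doubleton_eq_iff eq)
    then show "i = j"
    proof cases
      case 2
      then have "int i - int (j + m) = 0" using ij by (intro small_dvd_imp_zero) auto
      then show ?thesis using ij by simp
    qed (use small ij in auto)
  qed
  have inj1: "inj_on (f 1) {..<2 * m}"
  proof (rule inj_onI)
    fix i j assume ij: "i \<in> {..<2 * m}" "j \<in> {..<2 * m}" "f 1 i = f 1 j"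
    then consider "int (2 * m) dvd int i - int j"
      | "int (2 * m) dvd int i - int (j + m + 1)" "int (2 * m) dvd int (i + m + 1) - int j"
      by (auto simp: f_def doubleton_eq_iff eq)
    then show "i = j"
    proof cases
      case 2
      \<comment> \<open>A near-diameter counted from both ends would make \<open>2 * m\<close>
        divide \<open>2\<close>, impossible for \<open>m \<ge> 2\<close>.\<close>
      have "int (2 * m) dvd (int (i + m + 1) - int j) - (int i - int (j + m + 1))"
        by (rule dvd_diff[OF 2(2,1)])
      then have "int (2 * m) dvd int (2 * m) + 2" by (simp add: algebra_simps)
      then show ?thesis using no_dvd(2) dvd_add_triv_left_iff by blast
    qed (use small ij in auto)
  qed
  have disj: "f 0 ` {..<m} \<inter> f 1 ` {..<2 * m} = {}"
  proof (rule ccontr)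
    assume "\<not> ?thesis"
    then obtain i j where "f 0 i = f 1 j" by blast
    then consider "int (2 * m) dvd int i - int j" "int (2 * m) dvd int (i + m) - int (j + m + 1)"
      | "int (2 * m) dvd int i - int (j + m + 1)" "int (2 * m) dvd int (i + m) - int j"
      by (auto simp: f_def doubleton_eq_iff eq)
    then show False
    proof cases
      case 1
      have "int (2 * m) dvd (int i - int j) - (int (i + m) - int (j + m + 1))"
        by (rule dvd_diff[OF 1])
      then show False using no_dvd(1) by simp
    next
      case 2
      have "int (2 * m) dvd (int (i + m) - int j) - (int i - int (j + m + 1))"
        by (rule dvd_diff[OF 2(2,1)])
      then have "int (2 * m) dvd int (2 * m) + 1" by (simp add: algebra_simps)
      then show False using no_dvd(1) dvd_add_triv_left_iff by blast
    qed
  qed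
  have "3 * m = card (f 0 ` {..<m}) + card (f 1 ` {..<2 * m})"
    using inj0 inj1 by (simp add: card_image)
  also have "\<dots> = card (f 0 ` {..<m} \<union> f 1 ` {..<2 * m})"
    using disj by (simp add: card_Un_disjoint)
  also have "\<dots> \<le> card (double_normal_pairs W)"
    using pair by (intro card_mono[OF fin_N]) auto
  finally show ?thesis by (simp add: num_double_normals_def)
qed

text \<open>Three points correspond to \<open>m = 1\<close>, outside the range of the polygon
  count.\<close>

lemma right_triangle:
  fixes V :: "(real ^ 2) set"
  defines "V \<equiv> {vector [0, 0], vector [1, 0], vector [0, 1]}"
  shows "card V = 3" "3 \<le> num_double_normals V"
proof -
  let ?o = "vector [0, 0] :: real ^ 2" and ?a = "vector [1, 0] :: real ^ 2"
    and ?b = "vector [0, 1] :: real ^ 2"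
  have d: "?o \<noteq> ?a" "?o \<noteq> ?b" "?a \<noteq> ?b" by (simp_all add: vec_eq_iff forall_2)
  then show "card V = 3" by (simp add: V_def)
  have strips: "V \<subseteq> normal_strip ?o ?a" "V \<subseteq> normal_strip ?o ?b" "V \<subseteq> normal_strip ?a ?b"
    by (auto simp: V_def normal_strip_def inner_vec_def sum_2)
  have "{{?o, ?a}, {?o, ?b}, {?a, ?b}} \<subseteq> double_normal_pairs V"
    using strips d unfolding double_normal_pairs_def V_def by blast
  moreover have "finite (double_normal_pairs V)"
    by (rule finite_double_normal_pairs) (simp add: V_def)
  ultimately have "card {{?o, ?a}, {?o, ?b}, {?a, ?b}} \<le> num_double_normals V"
    unfolding num_double_normals_def by (rule card_mono[rotated])
  then show "3 \<le> num_double_normals V"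
    using d by (simp add: doubleton_eq_iff)
qed

theorem theorem1:
  shows "(\<forall>V :: (real ^ 2) set. finite V \<and> card V \<ge> 3 \<longrightarrow>
            num_double_normals V \<le> 3 * (card V div 2))
       \<and> (\<forall>n::nat. n \<ge> 3 \<longrightarrow>
            (\<exists>V :: (real ^ 2) set. finite V \<and> card V = n \<and>
               num_double_normals V = 3 * (n div 2)))
       \<and> (\<forall>V :: (real ^ 2) set. finite V \<and> card V \<ge> 3 \<and> even (card V) \<and>
              real (num_double_normals V) = 3 * real (card V) / 2 \<longrightarrow>
            (\<exists>c r. r > 0 \<and> V \<subseteq> sphere c r \<and> symmetric_about c V))"
proof (intro conjI allI impI; (elim conjE)?)
  fix V :: "(real ^ 2) set"
  assume "finite V"
  then show "num_double_normals V \<le> 3 * (card V div 2)"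
    by (rule num_double_normals_le_sharp)
next
  fix n :: nat
  assume n: "n \<ge> 3"
  have "\<exists>V :: (real ^ 2) set. finite V \<and> card V = n \<and> 3 * (n div 2) \<le> num_double_normals V"
  proof (cases "n = 3")
    case True
    then show ?thesis using right_triangle by (intro exI conjI) auto
  next
    case False
    define m where "m = n div 2"
    have m: "2 \<le> m" "0 < m" using n False by (auto simp: m_def)
    have fin: "finite (gon m)" by (simp add: gon_def)
    show ?thesis
    proof (cases "even n")
      case True
      then show ?thesis
        using card_gon[OF m(2)] num_double_normals_gon[OF m(1), of "gon m"] fin
        by (intro exI[of _ "gon m"]) (auto simp: m_def)
    next
      case False
      \<comment> \<open>For odd \<open>n\<close> the centre is added to the polygon.\<close>
      then have "card (insert 0 (gon m)) = n"
        using card_gon[OF m(2)] fin zero_notin_gon by (simp add: m_def)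
      then show ?thesis
        using num_double_normals_gon[OF m(1), of "insert 0 (gon m)"] fin
        by (intro exI[of _ "insert 0 (gon m)"]) (auto simp: m_def)
    qed
  qed
  then show "\<exists>V :: (real ^ 2) set. finite V \<and> card V = n \<and> num_double_normals V = 3 * (n div 2)"
    using num_double_normals_le_sharp by (metis le_antisym)
next
  fix V :: "(real ^ 2) set"
  assume V: "finite V" "card V \<ge> 3" "even (card V)"
    and N: "real (num_double_normals V) = 3 * real (card V) / 2"
  from V(3) obtain m where m: "card V = 2 * m" by blast
  then have "real (num_double_normals V) = real (3 * m)" using N by simp
  then have "num_double_normals V = 3 * m" by (simp only: of_nat_eq_iff)
  then have "tight V" using V(1) m by (simp add: tight_def)
  moreover have "V \<noteq> {}" using V(2) by auto
  ultimately show "\<exists>c r. r > 0 \<and> V \<subseteq> sphere c r \<and> symmetric_about c V"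
    by (rule tight_circle)
qed

end
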